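(* There is a real constant $c$ with $|c-1595.47|\le 0.005$ such that for every integer $n\ge 4$ the Balaban index of the third type of hex derived network $HDN3(n)$ is $$J(HDN3(n))=\frac{(20-41n+21n^2)\Big(c+7\big(-307-270\sqrt2+12\sqrt5+54\sqrt{10}\big)n+210\,(5+3\sqrt2)\,n^2\Big)}{70\,(43-84n+42n^2)}.$$
   Context: All graphs are finite, simple and undirected; $\kappa(p)$ denotes the degree of a vertex $p$ in a graph $G$. Hexagonal mesh $HX(n)$: the graph whose vertices are the integer triples $(x,y,z)$ with $x+y+z=0$ and $\max(|x|,|y|,|z|)\le n-1$, two vertices being adjacent iff their difference is a permutation of $(1,-1,0)$. (So $HX(2)$ consists of six triangles around a common vertex, and $HX(n)$ is obtained from $HX(n-1)$ by adding one layer of triangles around the boundary.) Third type of hex derived network $HDN3(n)$: obtained from $HX(n)$ by replacing each $K_3$ subgraph (triangle) of $HX(n)$ by a planar octahedron, once. That is, for each triangle with vertices $a,b,c$, all edges of the triangle are kept, three new vertices $u_{ab},u_{bc},u_{ca}$ (private to that triangle) are added, the new vertices are made pairwise adjacent, and $u_{ab}$ is joined to $a$ and $b$, $u_{bc}$ to $b$ and $c$, $u_{ca}$ to $c$ and $a$. Balaban index (in the sense used here): for a graph $G$, $$J(G)=\frac{|E(G)|}{|E(G)|-|V(G)|+2}\sum_{pq\in E(G)}\frac{1}{\sqrt{\kappa(p)\,\kappa(q)}}.$$ *)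

theory Defs
  imports Complex_Main "HOL-Library.Multiset"
begin

record 'a ugraph =
  verts :: "'a set"
  edges :: "'a set set"

definition degree :: "'a ugraph \<Rightarrow> 'a \<Rightarrow> nat" where
  "degree G p = card {e \<in> edges G. p \<in> e}"

text \<open>An edge is a set \<open>{p, q}\<close> with \<open>p \<noteq> q\<close>, so the product over the edge below is
  \<open>degree G p * degree G q\<close>. The cyclomatic term is computed in the reals, avoiding truncated
  subtraction.\<close>

definition balaban_index :: "'a ugraph \<Rightarrow> real" where
  "balaban_index G =
     real (card (edges G)) / (real (card (edges G)) - real (card (verts G)) + 2) *
     (\<Sum>e\<in>edges G. 1 / sqrt (\<Prod>p\<in>e. real (degree G p)))"

definition HX_verts :: "nat \<Rightarrow> (int \<times> int \<times> int) set" where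
  "HX_verts n =
     {(x, y, z). x + y + z = 0 \<and> max \<bar>x\<bar> (max \<bar>y\<bar> \<bar>z\<bar>) \<le> int n - 1}"

fun HX_adj :: "int \<times> int \<times> int \<Rightarrow> int \<times> int \<times> int \<Rightarrow> bool" where
  "HX_adj (x, y, z) (x', y', z') \<longleftrightarrow> mset [x - x', y - y', z - z'] = mset [1, -1, 0]"

definition HX :: "nat \<Rightarrow> (int \<times> int \<times> int) ugraph" where
  "HX n = \<lparr>verts = HX_verts n,
           edges = {{p, q} | p q. p \<in> HX_verts n \<and> q \<in> HX_verts n \<and> HX_adj p q}\<rparr>"

definition triangles :: "'a ugraph \<Rightarrow> 'a set set" where
  "triangles G =
     {T. T \<subseteq> verts G \<and> card T = 3 \<and> (\<forall>a\<in>T. \<forall>b\<in>T. a \<noteq> b \<longrightarrow> {a, b} \<in> edges G)}"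

text \<open>The new vertex \<open>u\<^sub>a\<^sub>b\<close> belonging to the triangle \<open>T\<close> is encoded as \<open>New T {a, b}\<close>; carrying
  \<open>T\<close> keeps it private to \<open>T\<close> even when the edge \<open>{a, b}\<close> lies in two triangles.\<close>

datatype 'a oct_vertex = Old 'a | New "'a set" "'a set"

definition triangle_sides :: "'a ugraph \<Rightarrow> 'a set \<Rightarrow> 'a set set" where
  "triangle_sides G T = {e \<in> edges G. e \<subseteq> T}"

definition replace_triangles_by_octahedra :: "'a ugraph \<Rightarrow> 'a oct_vertex ugraph" where
  "replace_triangles_by_octahedra G =
     \<lparr>verts = Old ` verts G \<union> {New T e | T e. T \<in> triangles G \<and> e \<in> triangle_sides G T},
      edges = {Old ` e | e. e \<in> edges G}
        \<union> {{New T e, New T f} | T e f.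
             T \<in> triangles G \<and> e \<in> triangle_sides G T \<and> f \<in> triangle_sides G T \<and> e \<noteq> f}
        \<union> {{New T e, Old a} | T e a. T \<in> triangles G \<and> e \<in> triangle_sides G T \<and> a \<in> e}\<rparr>"

definition HDN3 :: "nat \<Rightarrow> (int \<times> int \<times> int) oct_vertex ugraph" where
  "HDN3 n = replace_triangles_by_octahedra (HX n)"

end

theory Submission
  imports Defs
begin

text \<open>
  The index is determined by the numbers of vertices and edges and by the edge sum of the products of
  the weights \<open>1 / sqrt (degree p)\<close>. Each of these is first reduced to the mesh and then
  computed there.

  For any simple graph \<open>G\<close>, the new vertices of the octahedral graph correspond to flags, that is,
  to triangles of \<open>G\<close> with a chosen side. A flag with a side through \<open>v\<close> is the same as an ordered pair
  of adjacent neighbours of \<open>v\<close> (\<open>card_flags_at_vertex\<close>). Hence everything about the octahedral graph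
  can be expressed by two local numbers of a vertex of \<open>G\<close>: its degree, and the number of such ordered
  pairs. Their sum is the new degree of an old vertex, and new vertices have degree 4. Summation over
  arcs instead of edges then yields the number of edges (\<open>octahedra_card_edges\<close>) and the edge sum
  (\<open>octahedra_edge_sum\<close>).

  In the mesh the two numbers are 6 and 12 at interior vertices, 4 and 6 on sides, and 3 and 4 in
  corners, so that the old vertices have new degrees 18, 10 and 7. There are
  \<open>3 n\<^sup>2 - 9 n + 7\<close> interior vertices, \<open>6 n - 12\<close> side vertices and 6 corners.

  There remains the sum of \<open>w v * w q\<close> over the arcs \<open>(v, q)\<close> of the mesh, where \<open>w\<close> takes one value on
  the interior, one on the sides and one in the corners. Such a \<open>w\<close> is a combination of the constant 1
  and the indicators of the interior and of the corners, so the sum follows from the numbers of arcs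
  between these sets (\<open>arc_sum_two_indicators\<close>). All of these are degree sums or local counts at the
  six corners; for the arcs within the interior this holds because the interior is itself
  a mesh, with one layer less (\<open>arcs_between_HX\<close>). The result is a quadratic polynomial in \<open>n\<close> whose
  constant term, after scaling, is the number \<open>c\<close>.
\<close>

section \<open>Double counting in simple graphs\<close>

definition neighbours :: "'a ugraph \<Rightarrow> 'a \<Rightarrow> 'a set" where
  "neighbours G v = {q. {v, q} \<in> edges G}"

definition simple_graph :: "'a ugraph \<Rightarrow> bool" where
  "simple_graph G \<longleftrightarrow> finite (verts G) \<and> (\<forall>e\<in>edges G. e \<subseteq> verts G \<and> card e = 2)"

lemma simple_graph_finite_edges:
  assumes "simple_graph G" shows "finite (edges G)"
proof (rule finite_subset)
  show "edges G \<subseteq> Pow (verts G)" using assms by (auto simp: simple_graph_def)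
qed (use assms in \<open>auto simp: simple_graph_def\<close>)

lemma neighbours_sym: "q \<in> neighbours G v \<longleftrightarrow> v \<in> neighbours G q"
  by (simp add: neighbours_def insert_commute)

lemma neighbours_irrefl:
  assumes "simple_graph G" shows "v \<notin> neighbours G v"
  using assms by (force simp: neighbours_def simple_graph_def)

lemma neighbours_subset:
  assumes "simple_graph G" shows "neighbours G v \<subseteq> verts G"
  using assms by (auto simp: neighbours_def simple_graph_def)

lemma finite_neighbours:
  assumes "simple_graph G" shows "finite (neighbours G v)"
  using finite_subset[OF neighbours_subset[OF assms]] assms by (simp add: simple_graph_def)

lemma bij_betw_neighbours_incident_edges:
  assumes "simple_graph G"
  shows "bij_betw (\<lambda>q. {v, q}) (neighbours G v) {e \<in> edges G. v \<in> e}"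
proof -
  have "\<exists>q. e = {v, q}" if "e \<in> edges G" "v \<in> e" for e
  proof -
    have "card e = 2" using assms that by (simp add: simple_graph_def)
    then obtain a b where "e = {a, b}" by (auto simp: card_2_iff)
    then show ?thesis using that by (cases "v = a") auto
  qed
  then show ?thesis
    by (fastforce simp: bij_betw_def inj_on_def neighbours_def doubleton_eq_iff)
qed

lemma degree_eq_card_neighbours:
  assumes "simple_graph G"
  shows "degree G v = card (neighbours G v)"
  unfolding degree_def using bij_betw_same_card[OF bij_betw_neighbours_incident_edges[OF assms]] by metis

text \<open>Each edge is seen once from each of its two ends. All edge counts and edge sums below are
  obtained from sums over ordered pairs of adjacent vertices (arcs) in this way.\<close>

lemma handshake_sum:
  fixes f :: "'a set \<Rightarrow> real"
  assumes "simple_graph G"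
  shows "2 * (\<Sum>e\<in>edges G. f e) = (\<Sum>v\<in>verts G. \<Sum>q\<in>neighbours G v. f {v, q})"
proof -
  have fin: "finite (verts G)" "finite (edges G)"
    using assms simple_graph_finite_edges by (auto simp: simple_graph_def)
  have "(\<Sum>v\<in>verts G. \<Sum>q\<in>neighbours G v. f {v, q})
      = (\<Sum>v\<in>verts G. \<Sum>e\<in>{e \<in> edges G. v \<in> e}. f e)"
    by (intro sum.cong refl sum.reindex_bij_betw bij_betw_neighbours_incident_edges[OF assms])
  also have "\<dots> = (\<Sum>e\<in>edges G. \<Sum>v\<in>{v \<in> verts G. v \<in> e}. f e)"
    using fin by (rule sum.swap_restrict)
  also have "\<dots> = (\<Sum>e\<in>edges G. 2 * f e)"
  proof (intro sum.cong refl)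
    fix e assume "e \<in> edges G"
    then have "{v \<in> verts G. v \<in> e} = e" "card e = 2" using assms by (auto simp: simple_graph_def)
    then show "(\<Sum>v\<in>{v \<in> verts G. v \<in> e}. f e) = 2 * f e" by simp
  qed
  finally show ?thesis by (simp add: sum_distrib_left)
qed

lemma handshake:
  assumes "simple_graph G"
  shows "2 * card (edges G) = (\<Sum>v\<in>verts G. degree G v)"
proof -
  have "2 * real (card (edges G)) = (\<Sum>v\<in>verts G. real (degree G v))"
    using handshake_sum[OF assms, of "\<lambda>_. 1"] by (simp add: degree_eq_card_neighbours[OF assms])
  also have "\<dots> = real (\<Sum>v\<in>verts G. degree G v)" by simp
  finally show ?thesis by (metis of_nat_eq_iff of_nat_mult of_nat_numeral)
qed

lemma sum_edge_products:
  fixes w :: "'a \<Rightarrow> real"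
  assumes "simple_graph G"
  shows "2 * (\<Sum>e\<in>edges G. \<Prod>p\<in>e. w p) = (\<Sum>v\<in>verts G. w v * (\<Sum>q\<in>neighbours G v. w q))"
  unfolding handshake_sum[OF assms] unfolding sum_distrib_left
proof (intro sum.cong refl)
  fix v q assume "q \<in> neighbours G v"
  then have "v \<noteq> q" using neighbours_irrefl[OF assms] by metis
  then show "(\<Prod>p\<in>{v, q}. w p) = w v * w q" by simp
qed

section \<open>Flags: triangles with a chosen side\<close>

text \<open>A flag is a triangle with one of its sides; flags index the new vertices of the octahedral
  graph.\<close>

definition flags :: "'a ugraph \<Rightarrow> ('a set \<times> 'a set) set" where
  "flags G = Sigma (triangles G) (triangle_sides G)"

text \<open>The pairs \<open>(q, r)\<close> for which \<open>v, q, r\<close> is a triangle, read as the walk that first goes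
  from \<open>v\<close> to \<open>q\<close>; such a pair also selects the side \<open>{v, q}\<close> of the triangle.\<close>

definition triangle_arcs :: "'a ugraph \<Rightarrow> 'a \<Rightarrow> ('a \<times> 'a) set" where
  "triangle_arcs G v = Sigma (neighbours G v) (\<lambda>q. neighbours G v \<inter> neighbours G q)"

lemma finite_flags:
  assumes "simple_graph G" shows "finite (flags G)"
proof (rule finite_subset)
  show "flags G \<subseteq> Pow (verts G) \<times> edges G"
    by (auto simp: flags_def triangles_def triangle_sides_def)
qed (use assms simple_graph_finite_edges in \<open>auto simp: simple_graph_def\<close>)

lemma flag_edge:
  assumes "simple_graph G" "(T, e) \<in> flags G"
  shows "e \<in> edges G" "e \<subseteq> T" "e \<subseteq> verts G" "card e = 2" "finite e"
  using assms card_ge_0_finite[of e] by (auto simp: flags_def triangles_def triangle_sides_def simple_graph_def)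

lemma triangle_sides_triangle:
  assumes "simple_graph G" "T \<in> triangles G"
  obtains a b c where "T = {a, b, c}" "a \<noteq> b" "b \<noteq> c" "a \<noteq> c"
    "triangle_sides G T = {{a, b}, {b, c}, {a, c}}"
proof -
  from assms(2) obtain a b c where T: "T = {a, b, c}" "a \<noteq> b" "b \<noteq> c" "a \<noteq> c"
    by (auto simp: triangles_def card_3_iff)
  have "e \<in> {{a, b}, {b, c}, {a, c}}" if "e \<in> triangle_sides G T" for e
  proof -
    have "card e = 2" "e \<subseteq> {a, b, c}"
      using that assms(1) T by (auto simp: triangle_sides_def simple_graph_def)
    then obtain p q where "e = {p, q}" "p \<noteq> q" by (auto simp: card_2_iff)
    with \<open>e \<subseteq> {a, b, c}\<close> show ?thesis by (auto simp: doubleton_eq_iff)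
  qed
  moreover have "{{a, b}, {b, c}, {a, c}} \<subseteq> triangle_sides G T"
    using assms(2) T by (auto simp: triangles_def triangle_sides_def)
  ultimately have "triangle_sides G T = {{a, b}, {b, c}, {a, c}}" by blast
  with T show thesis using that by blast
qed

lemma card_triangle_sides:
  assumes "simple_graph G" "T \<in> triangles G"
  shows "card (triangle_sides G T) = 3"
  using assms by (rule triangle_sides_triangle) (simp add: doubleton_eq_iff)

text \<open>A triangle at \<open>v\<close> with a side through \<open>v\<close> is the same as an ordered choice of the two
  other vertices: the chosen side ends in the first one. So flags can be counted locally, without
  listing the triangles of the graph.\<close>

lemma card_flags_at_vertex:
  assumes "simple_graph G"
  shows "card {F \<in> flags G. v \<in> snd F} = card (triangle_arcs G v)"
proof -
  have "bij_betw (\<lambda>(q, r). ({v, q, r}, {v, q})) (triangle_arcs G v) {F \<in> flags G. v \<in> snd F}"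
    unfolding bij_betw_def
  proof
    show "inj_on (\<lambda>(q, r). ({v, q, r}, {v, q})) (triangle_arcs G v)"
    proof -
      have "q = q' \<and> r = r'"
        if "(q, r) \<in> triangle_arcs G v" "(q', r') \<in> triangle_arcs G v"
          "{v, q, r} = {v, q', r'}" "{v, q} = {v, q'}" for q r q' r'
      proof -
        have q: "q = q'" using that(4) by (auto simp: doubleton_eq_iff)
        have "r \<notin> {v, q}" "r' \<notin> {v, q'}"
          using that(1,2) neighbours_irrefl[OF assms] by (auto simp: triangle_arcs_def)
        with that(3) q have "{r} = {v, q, r} - {v, q}" "{r'} = {v, q, r} - {v, q}" by blast+
        then have "r = r'" by (metis singleton_inject)
        with q show ?thesis by simp
      qed
      then show ?thesis by (fastforce intro!: inj_onI)
    qed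
    show "(\<lambda>(q, r). ({v, q, r}, {v, q})) ` triangle_arcs G v = {F \<in> flags G. v \<in> snd F}"
    proof (intro equalityI subsetI)
      fix F assume "F \<in> (\<lambda>(q, r). ({v, q, r}, {v, q})) ` triangle_arcs G v"
      then obtain q r where qr: "F = ({v, q, r}, {v, q})" "q \<in> neighbours G v"
        "r \<in> neighbours G v" "r \<in> neighbours G q" by (auto simp: triangle_arcs_def)
      then have "v \<noteq> q" "v \<noteq> r" "q \<noteq> r" using neighbours_irrefl[OF assms] by blast+
      with qr show "F \<in> {F \<in> flags G. v \<in> snd F}" using assms
        by (auto simp: flags_def triangles_def triangle_sides_def neighbours_def insert_commute
            simple_graph_def)
    next
      fix F assume F: "F \<in> {F \<in> flags G. v \<in> snd F}"
      then obtain T e where Te: "F = (T, e)" "T \<in> triangles G" "e \<in> triangle_sides G T" "v \<in> e"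
        by (auto simp: flags_def)
      then have e: "e \<in> edges G" "e \<subseteq> T" by (auto simp: triangle_sides_def)
      with Te assms obtain q where q: "e = {v, q}" "v \<noteq> q"
        using bij_betw_imp_surj_on[OF bij_betw_neighbours_incident_edges[OF assms, of v]]
          neighbours_irrefl[OF assms] by blast
      have "card (T - e) = 1"
        using Te(2) e(2) q by (subst card_Diff_subset) (auto simp: triangles_def)
      then obtain r where "T - e = {r}" by (auto simp: card_1_singleton_iff)
      then have r: "T = {v, q, r}" "r \<noteq> v" "r \<noteq> q" using e q by auto
      then have "(q, r) \<in> triangle_arcs G v"
        using Te(2) q by (auto simp: triangle_arcs_def neighbours_def triangles_def)
      then show "F \<in> (\<lambda>(q, r). ({v, q, r}, {v, q})) ` triangle_arcs G v"
        using Te q r by force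
    qed
  qed
  from bij_betw_same_card[OF this] show ?thesis by simp
qed

lemma sum_over_flag_ends:
  fixes w :: "'a \<Rightarrow> real"
  assumes "simple_graph G"
  shows "(\<Sum>(T, e)\<in>flags G. \<Sum>a\<in>e. w a) = (\<Sum>v\<in>verts G. real (card (triangle_arcs G v)) * w v)"
proof -
  have fin: "finite (verts G)" using assms by (simp add: simple_graph_def)
  have "(\<Sum>(T, e)\<in>flags G. \<Sum>a\<in>e. w a) = (\<Sum>F\<in>flags G. \<Sum>v\<in>{v \<in> verts G. v \<in> snd F}. w v)"
    using flag_edge(3)[OF assms] by (intro sum.cong refl) (auto intro!: sum.cong)
  also have "\<dots> = (\<Sum>v\<in>verts G. \<Sum>F\<in>{F \<in> flags G. v \<in> snd F}. w v)"
    using finite_flags[OF assms] fin by (rule sum.swap_restrict)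
  finally show ?thesis by (simp add: card_flags_at_vertex[OF assms])
qed

text \<open>Every flag is counted at both ends of its side.\<close>

lemma card_flags:
  assumes "simple_graph G"
  shows "2 * real (card (flags G)) = (\<Sum>v\<in>verts G. real (card (triangle_arcs G v)))"
proof -
  have "(\<Sum>(T, e)\<in>flags G. \<Sum>a\<in>e. 1 :: real) = (\<Sum>F\<in>flags G. 2)"
    using flag_edge(4)[OF assms] by (intro sum.cong refl) auto
  then show ?thesis using sum_over_flag_ends[OF assms, of "\<lambda>_. 1"] by simp
qed

section \<open>Replacing triangles by octahedra\<close>

abbreviation octahedral :: "'a ugraph \<Rightarrow> 'a oct_vertex ugraph" where
  "octahedral \<equiv> replace_triangles_by_octahedra"

context
  fixes G :: "'a ugraph"
  assumes simple: "simple_graph G"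
begin

lemma verts_octahedra: "verts (octahedral G) = Old ` verts G \<union> (\<lambda>(T, e). New T e) ` flags G"
  by (auto simp: replace_triangles_by_octahedra_def flags_def)

lemma octahedra_simple_graph: "simple_graph (octahedral G)"
proof -
  have "finite (verts (octahedral G))"
    using simple finite_flags[OF simple] by (simp add: verts_octahedra simple_graph_def)
  moreover have "e \<subseteq> verts (octahedral G) \<and> card e = 2" if "e \<in> edges (octahedral G)" for e
  proof -
    from that consider (old) x where "x \<in> edges G" "e = Old ` x"
      | (new) T f g where "(T, f) \<in> flags G" "(T, g) \<in> flags G" "f \<noteq> g" "e = {New T f, New T g}"
      | (mixed) T f a where "(T, f) \<in> flags G" "a \<in> f" "e = {New T f, Old a}"
      by (simp add: replace_triangles_by_octahedra_def flags_def) blast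
    then show ?thesis
    proof cases
      case old
      then have "x \<subseteq> verts G" "card x = 2" using simple by (auto simp: simple_graph_def)
      with old show ?thesis by (auto simp: verts_octahedra card_image inj_on_def)
    next
      case new
      then show ?thesis by (force simp: verts_octahedra)
    next
      case mixed
      then show ?thesis using flag_edge(3)[OF simple] by (force simp: verts_octahedra)
    qed
  qed
  ultimately show ?thesis by (simp add: simple_graph_def)
qed

lemma octahedra_neighbours_Old:
  "neighbours (octahedral G) (Old v) = Old ` neighbours G v \<union> (\<lambda>(T, e). New T e) ` {F \<in> flags G. v \<in> snd F}"
proof -
  have "q \<in> neighbours (octahedral G) (Old v) \<longleftrightarrow>
     q \<in> Old ` neighbours G v \<union> (\<lambda>(T, e). New T e) ` {F \<in> flags G. v \<in> snd F}" for q
  proof (cases q)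
    case (Old a)
    have "{Old v, Old a} = Old ` e \<longleftrightarrow> e = {v, a}" for e
      using inj_image_eq_iff[of Old "{v, a}" e] by (auto simp: inj_def)
    with Old show ?thesis
      by (auto simp: neighbours_def replace_triangles_by_octahedra_def doubleton_eq_iff)
  next
    case (New T e)
    have "{Old v, New T e} \<noteq> Old ` x" for x by blast
    with New show ?thesis
      by (force simp: neighbours_def replace_triangles_by_octahedra_def doubleton_eq_iff flags_def)
  qed
  then show ?thesis by blast
qed

lemma octahedra_neighbours_New:
  assumes "(T, e) \<in> flags G"
  shows "neighbours (octahedral G) (New T e) = Old ` e \<union> New T ` (triangle_sides G T - {e})"
proof -
  have "q \<in> neighbours (octahedral G) (New T e) \<longleftrightarrow> q \<in> Old ` e \<union> New T ` (triangle_sides G T - {e})" for q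
  proof (cases q)
    case (Old a)
    have "{New T e, Old a} \<noteq> Old ` x" for x by blast
    with Old assms show ?thesis
      by (auto simp: neighbours_def replace_triangles_by_octahedra_def doubleton_eq_iff flags_def)
  next
    case (New T' f)
    have "{New T e, New T' f} \<noteq> Old ` x" for x by blast
    with New assms show ?thesis
      by (fastforce simp: neighbours_def replace_triangles_by_octahedra_def doubleton_eq_iff flags_def)
  qed
  then show ?thesis by blast
qed

lemma inj_New: "inj_on (\<lambda>F. New (fst F) (snd F)) A"
  by (auto simp: inj_on_def)

lemma sum_octahedra_neighbours_Old:
  fixes w :: "'a oct_vertex \<Rightarrow> real"
  shows "(\<Sum>q\<in>neighbours (octahedral G) (Old v). w q) =
    (\<Sum>q\<in>neighbours G v. w (Old q)) + (\<Sum>F\<in>{F \<in> flags G. v \<in> snd F}. w (New (fst F) (snd F)))"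
  unfolding octahedra_neighbours_Old
  by (subst sum.union_disjoint)
    (auto simp: finite_neighbours[OF simple] finite_flags[OF simple] sum.reindex inj_New inj_on_def
      case_prod_beta)

lemma sum_octahedra_neighbours_New:
  fixes w :: "'a oct_vertex \<Rightarrow> real"
  assumes "(T, e) \<in> flags G"
  shows "(\<Sum>q\<in>neighbours (octahedral G) (New T e). w q) =
    (\<Sum>a\<in>e. w (Old a)) + (\<Sum>f\<in>triangle_sides G T - {e}. w (New T f))"
proof -
  have "finite (triangle_sides G T)"
    using simple_graph_finite_edges[OF simple] by (simp add: triangle_sides_def)
  then show ?thesis unfolding octahedra_neighbours_New[OF assms]
    using flag_edge(5)[OF simple assms]
    by (subst sum.union_disjoint) (auto simp: sum.reindex inj_on_def)
qed

lemma card_other_sides: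
  assumes "(T, e) \<in> flags G" shows "card (triangle_sides G T - {e}) = 2"
  using assms card_triangle_sides[OF simple, of T] by (auto simp: flags_def)

lemma octahedra_degree_Old:
  "degree (octahedral G) (Old v) = degree G v + card (triangle_arcs G v)"
proof -
  have "real (degree (octahedral G) (Old v)) = real (degree G v + card (triangle_arcs G v))"
    using sum_octahedra_neighbours_Old[of "\<lambda>_. 1" v]
    by (simp add: degree_eq_card_neighbours[OF octahedra_simple_graph]
        degree_eq_card_neighbours[OF simple] card_flags_at_vertex[OF simple])
  then show ?thesis by (simp only: of_nat_eq_iff)
qed

lemma octahedra_degree_New:
  assumes "(T, e) \<in> flags G"
  shows "degree (octahedral G) (New T e) = 4"
proof -
  have "real (degree (octahedral G) (New T e)) = 4"
    using sum_octahedra_neighbours_New[OF assms, of "\<lambda>_. 1"] flag_edge(4)[OF simple assms]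
    by (simp only: degree_eq_card_neighbours[OF octahedra_simple_graph] sum_constant
        card_other_sides[OF assms])
  then show ?thesis by simp
qed

lemma sum_octahedra_verts:
  fixes f :: "'a oct_vertex \<Rightarrow> real"
  shows "(\<Sum>v\<in>verts (octahedral G). f v) = (\<Sum>v\<in>verts G. f (Old v)) + (\<Sum>(T, e)\<in>flags G. f (New T e))"
  unfolding verts_octahedra using simple finite_flags[OF simple]
  by (subst sum.union_disjoint)
    (auto simp: simple_graph_def sum.reindex inj_New inj_on_def case_prod_beta)

lemma octahedra_card_verts: "card (verts (octahedral G)) = card (verts G) + card (flags G)"
proof -
  have "real (card (verts (octahedral G))) = real (card (verts G) + card (flags G))"
    using sum_octahedra_verts[of "\<lambda>_. 1"] by (simp add: case_prod_beta)
  then show ?thesis by (simp only: of_nat_eq_iff)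
qed

text \<open>A triangle contributes three flags and nine additional edges, which gives three edges for
  each flag.\<close>

lemma octahedra_card_edges: "card (edges (octahedral G)) = card (edges G) + 3 * card (flags G)"
proof -
  have "2 * real (card (edges (octahedral G))) = (\<Sum>v\<in>verts (octahedral G). real (degree (octahedral G) v))"
    using handshake[OF octahedra_simple_graph] by (metis of_nat_mult of_nat_numeral of_nat_sum)
  also have "\<dots> = (\<Sum>v\<in>verts G. real (degree G v)) + (\<Sum>v\<in>verts G. real (card (triangle_arcs G v)))
      + (\<Sum>(T, e)\<in>flags G. 4)"
  proof -
    have "(\<Sum>(T, e)\<in>flags G. real (degree (octahedral G) (New T e))) = (\<Sum>(T, e)\<in>flags G. 4)"
      by (intro sum.cong refl) (auto simp: octahedra_degree_New)
    then show ?thesis unfolding sum_octahedra_verts octahedra_degree_Old by (simp add: sum.distrib)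
  qed
  also have "\<dots> = 2 * real (card (edges G)) + 2 * real (card (flags G)) + 4 * real (card (flags G))"
    using handshake[OF simple] card_flags[OF simple]
    by (simp add: case_prod_beta) (metis of_nat_mult of_nat_numeral of_nat_sum)
  finally have "real (card (edges (octahedral G))) = real (card (edges G) + 3 * card (flags G))" by simp
  then show ?thesis by (simp only: of_nat_eq_iff)
qed

text \<open>New vertices have degree 4, hence weight 1/2. The three kinds of edges then contribute as
  follows: an edge between old vertices its two weights, an edge between an old and a new vertex
  half the weight of the old one, and an edge between new vertices 1/4; there are as many edges of
  the last kind as flags, because a triangle has three of each.\<close>

lemma octahedra_edge_sum:
  fixes w :: "'a \<Rightarrow> real"
  assumes w: "\<And>v. w v = 1 / sqrt (real (degree (octahedral G) (Old v)))"
  shows "(\<Sum>e\<in>edges (octahedral G). 1 / sqrt (\<Prod>p\<in>e. real (degree (octahedral G) p))) =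
    (\<Sum>v\<in>verts G. w v * (\<Sum>q\<in>neighbours G v. w q)) / 2
    + (\<Sum>v\<in>verts G. real (card (triangle_arcs G v)) * w v) / 2 + real (card (flags G)) / 4"
proof -
  \<comment> \<open>\<open>u\<close> extends \<open>w\<close> to the new vertices, so that the summand is a product over the edge.\<close>
  define u where "u p = 1 / sqrt (real (degree (octahedral G) p))" for p
  have u_Old: "u (Old v) = w v" for v by (simp add: u_def w)
  have u_New: "u (New T e) = 1 / 2" if "(T, e) \<in> flags G" for T e
    using real_sqrt_abs[of 2] by (simp add: u_def octahedra_degree_New[OF that])
  have sqrt_prod: "sqrt (\<Prod>p\<in>A. f p) = (\<Prod>p\<in>A. sqrt (f p))" for A and f :: "'a oct_vertex \<Rightarrow> real"
    by (induction A rule: infinite_finite_induct) (auto simp: real_sqrt_mult)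
  have "2 * (\<Sum>e\<in>edges (octahedral G). 1 / sqrt (\<Prod>p\<in>e. real (degree (octahedral G) p)))
      = 2 * (\<Sum>e\<in>edges (octahedral G). \<Prod>p\<in>e. u p)"
    by (simp add: sqrt_prod u_def prod_dividef)
  also have "\<dots> = (\<Sum>v\<in>verts (octahedral G). u v * (\<Sum>q\<in>neighbours (octahedral G) v. u q))"
    by (rule sum_edge_products[OF octahedra_simple_graph])
  also have "\<dots> = (\<Sum>v\<in>verts G. u (Old v) * (\<Sum>q\<in>neighbours (octahedral G) (Old v). u q))
      + (\<Sum>(T, e)\<in>flags G. u (New T e) * (\<Sum>q\<in>neighbours (octahedral G) (New T e). u q))"
    by (rule sum_octahedra_verts)
  also have "(\<Sum>v\<in>verts G. u (Old v) * (\<Sum>q\<in>neighbours (octahedral G) (Old v). u q)) =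
      (\<Sum>v\<in>verts G. w v * (\<Sum>q\<in>neighbours G v. w q) + real (card (triangle_arcs G v)) * w v / 2)"
  proof (intro sum.cong refl)
    fix v
    have "(\<Sum>F\<in>{F \<in> flags G. v \<in> snd F}. u (New (fst F) (snd F))) = (\<Sum>F\<in>{F \<in> flags G. v \<in> snd F}. 1 / 2)"
      by (intro sum.cong refl) (auto simp: u_New)
    then show "u (Old v) * (\<Sum>q\<in>neighbours (octahedral G) (Old v). u q) =
      w v * (\<Sum>q\<in>neighbours G v. w q) + real (card (triangle_arcs G v)) * w v / 2"
      by (simp add: sum_octahedra_neighbours_Old u_Old card_flags_at_vertex[OF simple] algebra_simps)
  qed
  also have "(\<Sum>(T, e)\<in>flags G. u (New T e) * (\<Sum>q\<in>neighbours (octahedral G) (New T e). u q)) =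
      (\<Sum>(T, e)\<in>flags G. (\<Sum>a\<in>e. w a) / 2 + 1 / 2)"
  proof (intro sum.cong refl, clarify)
    fix T e assume F: "(T, e) \<in> flags G"
    then have "(\<Sum>f\<in>triangle_sides G T - {e}. u (New T f)) = (\<Sum>f\<in>triangle_sides G T - {e}. 1 / 2)"
      by (intro sum.cong refl u_New) (auto simp: flags_def)
    also have "\<dots> = 1" by (simp add: card_other_sides[OF F])
    finally show "u (New T e) * (\<Sum>q\<in>neighbours (octahedral G) (New T e). u q) = (\<Sum>a\<in>e. w a) / 2 + 1 / 2"
      using F by (simp add: sum_octahedra_neighbours_New u_New u_Old algebra_simps)
  qed
  also have "\<dots> = (\<Sum>v\<in>verts G. real (card (triangle_arcs G v)) * w v) / 2 + real (card (flags G)) / 2"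
    unfolding sum_over_flag_ends[OF simple, symmetric]
    by (simp add: case_prod_beta sum.distrib sum_divide_distrib)
  finally show ?thesis by (simp add: sum.distrib flip: sum_divide_distrib)
qed

end

section \<open>Local structure of the hexagonal mesh\<close>

lemma mset_unit_step_iff:
  "mset [p, q, r] = mset [1, -1, 0 :: int] \<longleftrightarrow> (p, q, r) \<in>
    {(-1, 1, 0), (1, -1, 0), (-1, 0, 1), (1, 0, -1), (0, -1, 1), (0, 1, -1)}"
proof
  assume "mset [p, q, r] = mset [1, -1, 0]"
  then have "set [p, q, r] = set [1, -1, 0]" by (rule mset_eq_setD)
  then have "{p, q, r} = {1, -1, 0}" by simp
  \<comment> \<open>Equality of the sets is enough: three entries that take three values are a permutation.\<close>
  then have mem: "p \<in> {1, -1, 0}" "q \<in> {1, -1, 0}" "r \<in> {1, -1, 0}"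
    and onto: "1 \<in> {p, q, r}" "-1 \<in> {p, q, r}" "0 \<in> {p, q, r}" by blast+
  from mem show "(p, q, r) \<in> {(-1, 1, 0), (1, -1, 0), (-1, 0, 1), (1, 0, -1), (0, -1, 1), (0, 1, -1)}"
    by (elim insertE emptyE) (use onto in simp_all)
qed (auto simp: add_mset_commute)

definition hex_neighbours :: "int \<times> int \<times> int \<Rightarrow> (int \<times> int \<times> int) set" where
  "hex_neighbours = (\<lambda>(x, y, z). {(x+1, y-1, z), (x-1, y+1, z), (x+1, y, z-1), (x-1, y, z+1),
     (x, y+1, z-1), (x, y-1, z+1)})"

lemma HX_adj_iff: "HX_adj v q \<longleftrightarrow> q \<in> hex_neighbours v"
proof -
  have eq: "s - t = k \<longleftrightarrow> t = s - k" for s t k :: int by auto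
  show ?thesis
    by (cases v; cases q; simp only: HX_adj.simps mset_unit_step_iff)
      (simp add: eq hex_neighbours_def)
qed

lemma hex_neighbours_sym: "q \<in> hex_neighbours v \<Longrightarrow> v \<in> hex_neighbours q"
  by (cases v; cases q; simp add: hex_neighbours_def; elim disjE; simp)

lemma HX_verts_iff: "(x, y, z) \<in> HX_verts n \<longleftrightarrow>
   z = - x - y \<and> \<bar>x\<bar> \<le> int n - 1 \<and> \<bar>y\<bar> \<le> int n - 1 \<and> \<bar>z\<bar> \<le> int n - 1"
  by (auto simp: HX_verts_def)

lemma neighbours_HX:
  assumes "v \<in> HX_verts n"
  shows "neighbours (HX n) v = HX_verts n \<inter> hex_neighbours v"
proof -
  have "q \<in> neighbours (HX n) v \<longleftrightarrow>
    (\<exists>a b. {v, q} = {a, b} \<and> a \<in> HX_verts n \<and> b \<in> HX_verts n \<and> b \<in> hex_neighbours a)" for q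
    by (simp add: neighbours_def HX_def HX_adj_iff del: split_paired_Ex)
  then have "q \<in> neighbours (HX n) v \<longleftrightarrow> q \<in> HX_verts n \<and> q \<in> hex_neighbours v" for q
    unfolding doubleton_eq_iff using assms hex_neighbours_sym by blast
  then show ?thesis by blast
qed

definition HX_corners :: "nat \<Rightarrow> (int \<times> int \<times> int) set" where
  "HX_corners n = (let m = int n - 1 in
     {(m, -m, 0), (m, 0, -m), (0, m, -m), (-m, m, 0), (-m, 0, m), (0, -m, m)})"

lemma card_HX_corners: "n \<ge> 2 \<Longrightarrow> card (HX_corners n) = 6"
  by (simp add: HX_corners_def Let_def)

lemma sum_hex_neighbours:
  "(\<Sum>q\<in>hex_neighbours (x, y, z). f q) = f (x+1, y-1, z) + f (x-1, y+1, z) + f (x+1, y, z-1)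
     + f (x-1, y, z+1) + f (x, y+1, z-1) + f (x, y-1, z+1)"
  for f :: "_ \<Rightarrow> nat"
  by (simp add: hex_neighbours_def)

text \<open>A unit step raises one coordinate and lowers another, so it leaves the mesh exactly when the
  raised one is maximal or the lowered one is minimal.\<close>

lemma hex_steps_inside:
  assumes "(x, y, z) \<in> HX_verts n"
  shows "(x+1, y-1, z) \<in> HX_verts n \<longleftrightarrow> x < int n - 1 \<and> y > 1 - int n"
    "(x-1, y+1, z) \<in> HX_verts n \<longleftrightarrow> x > 1 - int n \<and> y < int n - 1"
    "(x+1, y, z-1) \<in> HX_verts n \<longleftrightarrow> x < int n - 1 \<and> z > 1 - int n"
    "(x-1, y, z+1) \<in> HX_verts n \<longleftrightarrow> x > 1 - int n \<and> z < int n - 1"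
    "(x, y+1, z-1) \<in> HX_verts n \<longleftrightarrow> y < int n - 1 \<and> z > 1 - int n"
    "(x, y-1, z+1) \<in> HX_verts n \<longleftrightarrow> y > 1 - int n \<and> z < int n - 1"
  using assms by (auto simp: HX_verts_iff)

lemma finite_hex_neighbours: "finite (hex_neighbours v)"
  by (cases v) (simp add: hex_neighbours_def)

text \<open>In an interior vertex no coordinate is extremal, on a side exactly one is, and in a corner two
  are, of opposite sign. Three extremal coordinates are impossible, as they sum to zero. The signs in
  the case of a side follow because the two other coordinates share the amount of the extremal
  one.\<close>

lemma HX_position_cases:
  fixes x y z :: int
  assumes n: "n \<ge> 2" and V: "(x, y, z) \<in> HX_verts n"
  defines "m \<equiv> int n - 1"
  obtains (interior) "(x, y, z) \<in> HX_verts (n - 1)"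
     "x < m" "-m < x" "y < m" "-m < y" "z < m" "-m < z"
  | (corner) "(x, y, z) \<in> HX_corners n" "(x, y, z) \<notin> HX_verts (n - 1)"
  | (side) "(x, y, z) \<notin> HX_verts (n - 1)" "(x, y, z) \<notin> HX_corners n"
     "(x = m \<and> -m < y \<and> y < 0 \<and> -m < z \<and> z < 0) \<or> (x = -m \<and> 0 < y \<and> y < m \<and> 0 < z \<and> z < m)
      \<or> (y = m \<and> -m < x \<and> x < 0 \<and> -m < z \<and> z < 0) \<or> (y = -m \<and> 0 < x \<and> x < m \<and> 0 < z \<and> z < m)
      \<or> (z = m \<and> -m < y \<and> y < 0 \<and> -m < x \<and> x < 0) \<or> (z = -m \<and> 0 < y \<and> y < m \<and> 0 < x \<and> x < m)"
proof -
  have m: "m \<ge> 1" "int (n - 1) - 1 = m - 1" using n by (auto simp: m_def)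
  have sum: "z = - x - y" and abs: "\<bar>x\<bar> \<le> m" "\<bar>y\<bar> \<le> m" "\<bar>z\<bar> \<le> m"
    using V unfolding HX_verts_iff m_def by blast+
  show thesis
  proof (cases "(x, y, z) \<in> HX_verts (n - 1)")
    case True
    then have "\<bar>x\<bar> \<le> m - 1" "\<bar>y\<bar> \<le> m - 1" "\<bar>z\<bar> \<le> m - 1"
      unfolding HX_verts_iff m(2) by blast+
    with True show thesis by (intro interior) auto
  next
    case out: False
    show thesis
    proof (cases "(x, y, z) \<in> HX_corners n")
      case True
      with out show thesis by (rule corner[rotated])
    next
      case not_corner: False
      from out sum have "\<not> (\<bar>x\<bar> \<le> m - 1 \<and> \<bar>y\<bar> \<le> m - 1 \<and> \<bar>z\<bar> \<le> m - 1)"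
        unfolding HX_verts_iff m(2) by blast
      with abs have "\<bar>x\<bar> = m \<or> \<bar>y\<bar> = m \<or> \<bar>z\<bar> = m" by linarith
      then have ext: "x = m \<or> x = -m \<or> y = m \<or> y = -m \<or> z = m \<or> z = -m" using m(1) by linarith
      have bounds: "x \<le> m" "-m \<le> x" "y \<le> m" "-m \<le> y" "z \<le> m" "-m \<le> z"
        using abs by linarith+
      have nc: "\<not> (x = m \<and> y = -m)" "\<not> (x = m \<and> y = 0)" "\<not> (x = 0 \<and> y = m)"
        "\<not> (x = -m \<and> y = m)" "\<not> (x = -m \<and> y = 0)" "\<not> (x = 0 \<and> y = -m)"
        using not_corner sum by (auto simp: HX_corners_def Let_def m_def[symmetric])
      have "(x = m \<and> -m < y \<and> y < 0 \<and> -m < z \<and> z < 0) \<or> (x = -m \<and> 0 < y \<and> y < m \<and> 0 < z \<and> z < m)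
      \<or> (y = m \<and> -m < x \<and> x < 0 \<and> -m < z \<and> z < 0) \<or> (y = -m \<and> 0 < x \<and> x < m \<and> 0 < z \<and> z < m)
      \<or> (z = m \<and> -m < y \<and> y < 0 \<and> -m < x \<and> x < 0) \<or> (z = -m \<and> 0 < y \<and> y < m \<and> 0 < x \<and> x < m)"
        using ext
      proof (elim disjE)
        assume h: "x = m"
        then have "y \<noteq> -m" "y \<noteq> 0" using nc sum by auto
        then have "-m < y" "y < 0" "-m < z" "z < 0" using h bounds sum by linarith+
        with h show ?thesis by simp
      next
        assume h: "x = -m"
        then have "y \<noteq> m" "y \<noteq> 0" using nc sum by auto
        then have "0 < y" "y < m" "0 < z" "z < m" using h bounds sum by linarith+
        with h show ?thesis by simp
      next
        assume h: "y = m"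
        then have "x \<noteq> -m" "x \<noteq> 0" using nc sum by auto
        then have "-m < x" "x < 0" "-m < z" "z < 0" using h bounds sum by linarith+
        with h show ?thesis by simp
      next
        assume h: "y = -m"
        then have "x \<noteq> m" "x \<noteq> 0" using nc sum by auto
        then have "0 < x" "x < m" "0 < z" "z < m" using h bounds sum by linarith+
        with h show ?thesis by simp
      next
        assume h: "z = m"
        then have "x \<noteq> 0" "y \<noteq> 0" using nc sum by auto
        then have "-m < y" "y < 0" "-m < x" "x < 0" using h bounds sum by linarith+
        with h show ?thesis by simp
      next
        assume h: "z = -m"
        then have "x \<noteq> 0" "y \<noteq> 0" using nc sum by auto
        then have "0 < y" "y < m" "0 < x" "x < m" using h bounds sum by linarith+
        with h show ?thesis by simp
      qed
      with out not_corner show thesis by (rule side)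
    qed
  qed
qed

text \<open>The vertices of \<open>HX (n - 1)\<close> are the interior vertices of \<open>HX n\<close>. An extremal coordinate
  forbids two of the six steps; in a corner one step is forbidden by both extremal coordinates.\<close>

lemma card_neighbours_HX:
  assumes "n \<ge> 2" "v \<in> HX_verts n"
  shows "card (neighbours (HX n) v)
    = (if v \<in> HX_verts (n - 1) then 6 else if v \<in> HX_corners n then 3 else 4)"
proof -
  obtain x y z where v: "v = (x, y, z)" by (cases v)
  have count: "card (neighbours (HX n) v) = (\<Sum>q\<in>hex_neighbours v. if q \<in> HX_verts n then 1 else 0)"
    using finite_hex_neighbours[of v] unfolding neighbours_HX[OF assms(2)]
    by (simp add: sum.If_cases Int_commute)
  note count = count[unfolded v sum_hex_neighbours hex_steps_inside[OF assms(2)[unfolded v]]]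
  from assms(1) assms(2)[unfolded v] show ?thesis
  proof (cases rule: HX_position_cases)
    case interior
    then show ?thesis unfolding v count by simp
  next
    case corner
    then show ?thesis unfolding v count using assms(1)
      by (simp add: HX_corners_def Let_def; elim disjE conjE; simp)
  next
    case side
    from side(3) side(1,2) show ?thesis unfolding v count
      by (elim disjE conjE) simp_all
  qed
qed

text \<open>The six steps are arranged cyclically, and two of them span a triangle exactly when they are
  consecutive. Around an interior vertex this gives six triangles; four consecutive steps remain on
  a side and three in a corner, which leaves three and two triangles. Each triangle gives two
  arcs.\<close>

lemma card_triangle_arcs_HX:
  assumes "n \<ge> 2" "v \<in> HX_verts n"
  shows "card (triangle_arcs (HX n) v)
    = (if v \<in> HX_verts (n - 1) then 12 else if v \<in> HX_corners n then 4 else 6)"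
    (is "?count = _")
proof -
  obtain x y z where v: "v = (x, y, z)" by (cases v)
  have adj: "r \<in> neighbours (HX n) q \<longleftrightarrow> r \<in> HX_verts n \<and> r \<in> hex_neighbours q"
    if "q \<in> HX_verts n" for q r using neighbours_HX[OF that] by blast
  have "card (triangle_arcs (HX n) v) =
     card {p \<in> hex_neighbours v \<times> hex_neighbours v. fst p \<in> HX_verts n \<and> snd p \<in> HX_verts n
        \<and> snd p \<in> hex_neighbours (fst p)}"
    by (rule arg_cong[where f = card]) (auto simp: triangle_arcs_def adj assms(2))
  also have "\<dots> = (\<Sum>p\<in>hex_neighbours v \<times> hex_neighbours v. if fst p \<in> HX_verts n \<and> snd p \<in> HX_verts n
        \<and> snd p \<in> hex_neighbours (fst p) then 1 else 0)"
    using finite_hex_neighbours[of v] by (simp add: sum.If_cases Int_def)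
  also have "\<dots> = (\<Sum>q\<in>hex_neighbours v. \<Sum>r\<in>hex_neighbours v. if q \<in> HX_verts n \<and> r \<in> HX_verts n
        \<and> r \<in> hex_neighbours q then 1 else 0)"
    by (simp add: sum.cartesian_product case_prod_beta)
  finally have count: "?count = \<dots>" .
  note count = count[unfolded v sum_hex_neighbours hex_steps_inside[OF assms(2)[unfolded v]]]
  from assms(1) assms(2)[unfolded v] show ?thesis
  proof (cases rule: HX_position_cases)
    case interior
    then show ?thesis unfolding v count by (simp add: hex_neighbours_def)
  next
    case corner
    then show ?thesis unfolding v count using assms(1)
      by (simp add: HX_corners_def Let_def hex_neighbours_def; elim disjE conjE; simp)
  next
    case side
    from side(3) side(1,2) show ?thesis unfolding v count
      by (simp only: hex_neighbours_def case_prod_conv; elim disjE conjE; simp)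
  qed
qed

section \<open>Arcs between sets of vertices\<close>

definition arcs_between :: "'a ugraph \<Rightarrow> 'a set \<Rightarrow> 'a set \<Rightarrow> nat" where
  "arcs_between G A B = (\<Sum>v\<in>A. card (neighbours G v \<inter> B))"

lemma arcs_between_commute:
  assumes "finite A" "finite B"
  shows "arcs_between G A B = arcs_between G B A"
proof -
  have "arcs_between G A B = (\<Sum>v\<in>A. \<Sum>q\<in>{q \<in> B. q \<in> neighbours G v}. 1)"
    by (auto simp: arcs_between_def Int_def conj_commute intro!: sum.cong arg_cong[where f = card])
  also have "\<dots> = (\<Sum>q\<in>B. \<Sum>v\<in>{v \<in> A. q \<in> neighbours G v}. 1)"
    using assms by (rule sum.swap_restrict)
  also have "\<dots> = arcs_between G B A"
    by (auto simp: arcs_between_def Int_def conj_commute neighbours_sym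
        intro!: sum.cong arg_cong[where f = card])
  finally show ?thesis .
qed

lemma sum_indicator_arcs:
  assumes "finite V" "A \<subseteq> V"
  shows "(\<Sum>v\<in>V. of_bool (v \<in> A) * real (card (neighbours G v \<inter> B))) = real (arcs_between G A B)"
proof -
  have "(\<Sum>v\<in>V. of_bool (v \<in> A) * real (card (neighbours G v \<inter> B)))
      = (\<Sum>v\<in>A. of_bool (v \<in> A) * real (card (neighbours G v \<inter> B)))"
    using assms by (intro sum.mono_neutral_right) auto
  then show ?thesis by (simp add: arcs_between_def)
qed

text \<open>The double sum is a quadratic form in the weight, evaluated on a combination of the constant 1
  and two indicator functions; its matrix consists of arc counts. This replaces a classification of
  the edges by the positions of their ends.\<close>

lemma arc_sum_two_indicators:
  fixes w :: "'a \<Rightarrow> real"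
  assumes simple: "simple_graph G" and sub: "A \<subseteq> verts G" "B \<subseteq> verts G"
    and w: "\<And>v. v \<in> verts G \<Longrightarrow> w v = s + a * of_bool (v \<in> A) + b * of_bool (v \<in> B)"
  shows "(\<Sum>v\<in>verts G. w v * (\<Sum>q\<in>neighbours G v. w q)) =
    s\<^sup>2 * arcs_between G (verts G) (verts G)
    + a\<^sup>2 * arcs_between G A A + b\<^sup>2 * arcs_between G B B
    + 2 * s * a * arcs_between G A (verts G) + 2 * s * b * arcs_between G B (verts G)
    + 2 * a * b * arcs_between G B A"
proof -
  let ?V = "verts G"
  let ?n = "\<lambda>v X. real (card (neighbours G v \<inter> X))"
  have fin: "finite ?V" "finite A" "finite B"
    using simple sub finite_subset by (auto simp: simple_graph_def)
  have inner: "(\<Sum>q\<in>neighbours G v. w q) = s * ?n v ?V + a * ?n v A + b * ?n v B" for v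
  proof -
    have nbr: "neighbours G v \<subseteq> ?V" "finite (neighbours G v)"
      using neighbours_subset[OF simple] finite_neighbours[OF simple] by auto
    have "(\<Sum>q\<in>neighbours G v. w q)
        = (\<Sum>q\<in>neighbours G v. s + a * of_bool (q \<in> A) + b * of_bool (q \<in> B))"
      using nbr w by (intro sum.cong) auto
    also have "\<dots> = s * real (card (neighbours G v)) + a * ?n v A + b * ?n v B"
      using nbr(2) by (simp add: sum.distrib flip: sum_distrib_left)
    finally show ?thesis using nbr(1) by (simp add: Int_absorb2)
  qed
  have expand: "w v * (\<Sum>q\<in>neighbours G v. w q) =
      s\<^sup>2 * (of_bool (v \<in> ?V) * ?n v ?V) + s * a * (of_bool (v \<in> ?V) * ?n v A)
      + s * b * (of_bool (v \<in> ?V) * ?n v B)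
      + (a * s * (of_bool (v \<in> A) * ?n v ?V) + a\<^sup>2 * (of_bool (v \<in> A) * ?n v A)
      + a * b * (of_bool (v \<in> A) * ?n v B))
      + (b * s * (of_bool (v \<in> B) * ?n v ?V) + b * a * (of_bool (v \<in> B) * ?n v A)
      + b\<^sup>2 * (of_bool (v \<in> B) * ?n v B))" if "v \<in> ?V" for v
    unfolding inner w[OF that] using that by (simp add: algebra_simps power2_eq_square)
  have "(\<Sum>v\<in>?V. w v * (\<Sum>q\<in>neighbours G v. w q)) =
     s\<^sup>2 * arcs_between G ?V ?V + s * a * arcs_between G ?V A + s * b * arcs_between G ?V B
     + (a * s * arcs_between G A ?V + a\<^sup>2 * arcs_between G A A + a * b * arcs_between G A B)
     + (b * s * arcs_between G B ?V + b * a * arcs_between G B A + b\<^sup>2 * arcs_between G B B)"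
    by (rule trans[OF sum.cong[OF refl expand]], assumption)
      (simp only: sum.distrib sum_distrib_left[symmetric] sum_indicator_arcs[OF fin(1) subset_refl]
        sum_indicator_arcs[OF fin(1) sub(1)] sum_indicator_arcs[OF fin(1) sub(2)])
  also have "arcs_between G ?V A = arcs_between G A ?V" using fin by (intro arcs_between_commute)
  also have "arcs_between G ?V B = arcs_between G B ?V" using fin by (intro arcs_between_commute)
  also have "arcs_between G A B = arcs_between G B A" using fin by (intro arcs_between_commute)
  finally show ?thesis by (simp add: algebra_simps)
qed

section \<open>Global counts in the hexagonal mesh\<close>

lemma sum_row_lengths: "(\<Sum>x\<in>{- int m..int m}. c - \<bar>x\<bar>) = (2 * int m + 1) * c - int m * (int m + 1)"
proof (induction m)
  case (Suc m)
  have "{- int (Suc m)..int (Suc m)} = insert (- int (Suc m)) (insert (int (Suc m)) {- int m..int m})"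
    by auto
  then show ?case using Suc by (simp add: algebra_simps)
qed simp

lemma HX_verts_rows: "HX_verts n = (\<lambda>(x, y). (x, y, - x - y)) `
    (SIGMA x:{1 - int n..int n - 1}. {max (1 - int n) (1 - int n - x)..min (int n - 1) (int n - 1 - x)})"
proof -
  have "(x, y, z) \<in> HX_verts n \<longleftrightarrow> z = - x - y \<and> x \<in> {1 - int n..int n - 1}
      \<and> y \<in> {max (1 - int n) (1 - int n - x)..min (int n - 1) (int n - 1 - x)}" for x y z
    unfolding HX_verts_iff by auto
  then show ?thesis by (auto simp: image_iff)
qed

lemma finite_HX_verts: "finite (HX_verts n)"
  unfolding HX_verts_rows by auto

lemma card_HX_verts:
  assumes "n \<ge> 1"
  shows "int (card (HX_verts n)) = 3 * (int n)\<^sup>2 - 3 * int n + 1"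
proof -
  define m where "m = n - 1"
  have n: "int n = int m + 1" using assms by (simp add: m_def)
  have "inj_on (\<lambda>(x, y). (x, y, - x - y :: int)) A" for A :: "(int \<times> int) set"
    by (auto simp: inj_on_def)
  then have "int (card (HX_verts n)) = (\<Sum>x\<in>{- int m..int m}.
      int (card {max (1 - int n) (1 - int n - x)..min (int n - 1) (int n - 1 - x)}))"
    unfolding HX_verts_rows by (simp add: card_image card_SigmaI n)
  also have "\<dots> = (\<Sum>x\<in>{- int m..int m}. (2 * int m + 1) - \<bar>x\<bar>)"
    by (intro sum.cong refl) (auto simp: n)
  also have "\<dots> = 3 * (int n)\<^sup>2 - 3 * int n + 1"
    unfolding sum_row_lengths by (simp add: n algebra_simps power2_eq_square)
  finally show ?thesis .
qed

lemma real_card_HX_verts: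
  assumes "n \<ge> 1"
  shows "real (card (HX_verts n)) = 3 * (real n)\<^sup>2 - 3 * real n + 1"
  using arg_cong[OF card_HX_verts[OF assms], of real_of_int] by simp

lemma real_card_HX_inner:
  assumes "n \<ge> 2"
  shows "real (card (HX_verts (n - 1))) = 3 * (real n)\<^sup>2 - 9 * real n + 7"
  using real_card_HX_verts[of "n - 1"] assms
  by (simp add: of_nat_diff power2_eq_square algebra_simps)

lemma HX_simple_graph: "simple_graph (HX n)"
proof -
  have "p \<noteq> q" if "HX_adj p q" for p q
    using that unfolding HX_adj_iff by (cases p) (auto simp: hex_neighbours_def)
  then have "e \<subseteq> HX_verts n \<and> card e = 2" if "e \<in> edges (HX n)" for e
    using that unfolding HX_def ugraph.simps mem_Collect_eq by (elim exE conjE) simp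
  then show ?thesis by (simp add: simple_graph_def HX_def finite_HX_verts)
qed

lemma verts_HX [simp]: "verts (HX n) = HX_verts n"
  by (simp add: HX_def)

lemma HX_inner_subset: "HX_verts (n - 1) \<subseteq> HX_verts n"
  by (auto simp: HX_verts_def)

lemma HX_corners_subset: "n \<ge> 2 \<Longrightarrow> HX_corners n \<subseteq> HX_verts n - HX_verts (n - 1)"
  by (auto simp: HX_corners_def HX_verts_def Let_def)

lemma sum_HX_by_position:
  fixes f :: "int \<times> int \<times> int \<Rightarrow> real"
  assumes n: "n \<ge> 2"
    and f: "\<And>v. v \<in> HX_verts n \<Longrightarrow>
      f v = (if v \<in> HX_verts (n - 1) then a else if v \<in> HX_corners n then c else b)"
  shows "(\<Sum>v\<in>HX_verts n. f v) = a * (3 * (real n)\<^sup>2 - 9 * real n + 7) + c * 6 + b * (6 * real n - 12)"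
proof -
  let ?I = "HX_verts (n - 1)" and ?C = "HX_corners n"
  let ?S = "HX_verts n - ?I - ?C"
  have sub: "?I \<subseteq> HX_verts n" "?C \<subseteq> HX_verts n - ?I"
    using HX_inner_subset HX_corners_subset[OF n] by auto
  have fin: "finite (HX_verts n)" "finite ?I" "finite ?C"
    using finite_HX_verts by (auto simp: HX_corners_def Let_def)
  have V: "real (card (HX_verts n)) = 3 * (real n)\<^sup>2 - 3 * real n + 1"
    using real_card_HX_verts n by simp
  have I: "real (card ?I) = 3 * (real n)\<^sup>2 - 9 * real n + 7"
    using real_card_HX_inner n by simp
  have "card (HX_verts n) = card ?I + card (HX_verts n - ?I)"
    using fin sub by (metis card_Diff_subset card_mono le_add_diff_inverse)
  also have "card (HX_verts n - ?I) = 6 + card ?S"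
    using fin sub card_HX_corners[OF n] by (metis card_Diff_subset card_mono le_add_diff_inverse finite_Diff)
  finally have S: "real (card ?S) = 6 * real n - 12" using V I by simp
  have "(\<Sum>v\<in>HX_verts n. f v) = (\<Sum>v\<in>?I. f v) + ((\<Sum>v\<in>?C. f v) + (\<Sum>v\<in>?S. f v))"
    using fin sub by (metis sum.subset_diff add.commute finite_Diff)
  also have "(\<Sum>v\<in>?I. f v) = a * card ?I" using f sub by (subst sum.cong[OF refl, of _ _ "\<lambda>_. a"]) auto
  also have "(\<Sum>v\<in>?C. f v) = c * card ?C" using f sub by (subst sum.cong[OF refl, of _ _ "\<lambda>_. c"]) auto
  also have "(\<Sum>v\<in>?S. f v) = b * card ?S" using f sub by (subst sum.cong[OF refl, of _ _ "\<lambda>_. b"]) auto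
  finally show ?thesis unfolding I S card_HX_corners[OF n] by simp
qed

text \<open>For \<open>n = 2\<close> the corners form a cycle; from \<open>n = 3\<close> on a corner has two neighbours on sides and
  one in the interior.\<close>

lemma HX_corner_neighbours:
  assumes "n \<ge> 3" "v \<in> HX_corners n"
  shows "neighbours (HX n) v \<inter> HX_corners n = {}"
    and "card (neighbours (HX n) v \<inter> HX_verts (n - 1)) = 1"
proof -
  define m where "m = int n - 1"
  have m: "m \<ge> 2" "int (n - 1) - 1 = m - 1" using assms by (auto simp: m_def)
  have v: "v \<in> HX_verts n" using HX_corners_subset[of n] assms by auto
  from assms(2) have cases: "v \<in> {(m, -m, 0), (m, 0, -m), (0, m, -m), (-m, m, 0), (-m, 0, m), (0, -m, m)}"
    by (simp add: HX_corners_def Let_def m_def)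
  then have "hex_neighbours v \<inter> HX_corners n = {}"
    unfolding HX_corners_def Let_def m_def[symmetric] hex_neighbours_def using m(1)
    by (elim insertE emptyE) simp_all
  then show "neighbours (HX n) v \<inter> HX_corners n = {}"
    unfolding neighbours_HX[OF v] by blast
  have "neighbours (HX n) v \<inter> HX_verts (n - 1) = HX_verts (n - 1) \<inter> hex_neighbours v"
    unfolding neighbours_HX[OF v] using HX_inner_subset by blast
  then have "card (neighbours (HX n) v \<inter> HX_verts (n - 1)) =
     (\<Sum>q\<in>hex_neighbours v. if q \<in> HX_verts (n - 1) then 1 else 0)"
    using finite_hex_neighbours[of v] by (simp add: sum.If_cases Int_commute)
  also have "\<dots> = 1"
    using cases m(1)
    by (elim insertE emptyE; simp only: sum_hex_neighbours HX_verts_iff m(2); simp)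
  finally show "card (neighbours (HX n) v \<inter> HX_verts (n - 1)) = 1" .
qed

lemma sum_neighbours_HX:
  assumes "n \<ge> 2"
  shows "(\<Sum>v\<in>HX_verts n. real (card (neighbours (HX n) v))) = 18 * (real n)\<^sup>2 - 30 * real n + 12"
  by (subst sum_HX_by_position[OF assms, of _ 6 3 4])
    (use assms card_neighbours_HX in \<open>auto simp: algebra_simps\<close>)

text \<open>Arcs inside the interior are the arcs of the mesh with one layer removed, so that their number
  is a degree sum in \<open>HX (n - 1)\<close>.\<close>

lemma arcs_between_HX:
  assumes n: "n \<ge> 3"
  defines "V \<equiv> HX_verts n" and "I \<equiv> HX_verts (n - 1)" and "C \<equiv> HX_corners n"
  shows "real (arcs_between (HX n) V V) = 18 * (real n)\<^sup>2 - 30 * real n + 12"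
    "real (arcs_between (HX n) I I) = 18 * (real n)\<^sup>2 - 66 * real n + 60"
    "real (arcs_between (HX n) I V) = 18 * (real n)\<^sup>2 - 54 * real n + 42"
    "arcs_between (HX n) C V = 18"
    "arcs_between (HX n) C I = 6"
    "arcs_between (HX n) C C = 0"
proof -
  have n2: "n \<ge> 2" "n - 1 \<ge> 2" using n by auto
  have sub: "I \<subseteq> V" "C \<subseteq> V - I" using HX_inner_subset HX_corners_subset[OF n2(1)] by (auto simp: assms)
  have nbr: "neighbours (HX n) v \<inter> V = neighbours (HX n) v" for v
    using neighbours_subset[OF HX_simple_graph, of n v] by (simp add: V_def Int_absorb2)
  have C: "card C = 6" using card_HX_corners[OF n2(1)] by (simp add: C_def)
  show "real (arcs_between (HX n) V V) = 18 * (real n)\<^sup>2 - 30 * real n + 12"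
    using sum_neighbours_HX[OF n2(1)] by (simp add: arcs_between_def nbr) (simp add: V_def)
  have "neighbours (HX n) v \<inter> I = neighbours (HX (n - 1)) v" if "v \<in> I" for v
  proof -
    have v: "v \<in> HX_verts n" "v \<in> HX_verts (n - 1)" using that sub by (auto simp: I_def V_def)
    show ?thesis
      unfolding neighbours_HX[OF v(1)] neighbours_HX[OF v(2)] using sub by (auto simp: I_def V_def)
  qed
  then have "real (arcs_between (HX n) I I) = (\<Sum>v\<in>I. real (card (neighbours (HX (n - 1)) v)))"
    by (simp add: arcs_between_def)
  also have "\<dots> = 18 * (real n)\<^sup>2 - 66 * real n + 60"
    unfolding I_def sum_neighbours_HX[OF n2(2)] using n
    by (simp add: of_nat_diff power2_eq_square algebra_simps)
  finally show "real (arcs_between (HX n) I I) = 18 * (real n)\<^sup>2 - 66 * real n + 60" .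
  have "arcs_between (HX n) I V = (\<Sum>v\<in>I. 6)"
    using sub unfolding arcs_between_def nbr
    by (intro sum.cong refl) (use card_neighbours_HX[OF n2(1)] in \<open>auto simp: V_def I_def\<close>)
  moreover have "real (card I) = 3 * (real n)\<^sup>2 - 9 * real n + 7"
    using real_card_HX_inner[OF n2(1)] by (simp add: I_def)
  ultimately show "real (arcs_between (HX n) I V) = 18 * (real n)\<^sup>2 - 54 * real n + 42"
    by (simp add: power2_eq_square algebra_simps)
  have "arcs_between (HX n) C V = (\<Sum>v\<in>C. 3)"
    using sub unfolding arcs_between_def nbr
    by (intro sum.cong refl) (use card_neighbours_HX[OF n2(1)] in \<open>auto simp: V_def I_def C_def\<close>)
  then show "arcs_between (HX n) C V = 18" by (simp add: C)
  have "arcs_between (HX n) C I = (\<Sum>v\<in>C. 1)"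
    using HX_corner_neighbours(2)[OF n] unfolding arcs_between_def C_def I_def by (intro sum.cong refl)
  then show "arcs_between (HX n) C I = 6" by (simp add: C)
  show "arcs_between (HX n) C C = 0"
    using HX_corner_neighbours(1)[OF n] by (simp add: arcs_between_def C_def)
qed

section \<open>The Balaban index of the third type of hex derived network\<close>

text \<open>The number is 210 times the part of the edge sum that does not depend on \<open>n\<close>. Six decimals of
  each root suffice: the coefficients have absolute sum 2820, so the total error is below 0.003.\<close>

lemma balaban_constant_bounds:
  "\<bar>917 + 1470 * sqrt 2 - 756 * sqrt 10 + 360 * sqrt 7 + 36 * sqrt 70 + 30 * sqrt 14
     - 168 * sqrt 5 - 1595.47\<bar> \<le> (0.005 :: real)"
proof -
  have between: "l \<le> sqrt x \<and> sqrt x \<le> u" if "0 \<le> l" "0 \<le> u" "l\<^sup>2 \<le> x" "x \<le> u\<^sup>2" for l u x :: real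
    using that real_le_rsqrt real_le_lsqrt by blast
  have "1.414213 \<le> sqrt 2 \<and> sqrt 2 \<le> (1.414214::real)" by (rule between) (simp_all add: power2_eq_square)
  moreover have "3.162277 \<le> sqrt 10 \<and> sqrt 10 \<le> (3.162278::real)" by (rule between) (simp_all add: power2_eq_square)
  moreover have "2.645751 \<le> sqrt 7 \<and> sqrt 7 \<le> (2.645752::real)" by (rule between) (simp_all add: power2_eq_square)
  moreover have "8.366600 \<le> sqrt 70 \<and> sqrt 70 \<le> (8.366601::real)" by (rule between) (simp_all add: power2_eq_square)
  moreover have "3.741657 \<le> sqrt 14 \<and> sqrt 14 \<le> (3.741658::real)" by (rule between) (simp_all add: power2_eq_square)
  moreover have "2.236067 \<le> sqrt 5 \<and> sqrt 5 \<le> (2.236068::real)" by (rule between) (simp_all add: power2_eq_square)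
  ultimately show ?thesis unfolding abs_le_iff
    by (intro conjI; simp; linarith)
qed

lemma degree_HDN3_Old:
  assumes "n \<ge> 2" "v \<in> HX_verts n"
  shows "degree (HDN3 n) (Old v) =
    (if v \<in> HX_verts (n - 1) then 18 else if v \<in> HX_corners n then 7 else 10)"
  unfolding HDN3_def octahedra_degree_Old[OF HX_simple_graph]
    degree_eq_card_neighbours[OF HX_simple_graph]
    card_neighbours_HX[OF assms] card_triangle_arcs_HX[OF assms] by simp

lemma card_flags_HX:
  assumes "n \<ge> 2"
  shows "real (card (flags (HX n))) = 18 * (real n - 1)\<^sup>2"
proof -
  have "2 * real (card (flags (HX n))) = (\<Sum>v\<in>HX_verts n. real (card (triangle_arcs (HX n) v)))"
    using card_flags[OF HX_simple_graph] by simp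
  also have "\<dots> = 12 * (3 * (real n)\<^sup>2 - 9 * real n + 7) + 4 * 6 + 6 * (6 * real n - 12)"
    by (rule sum_HX_by_position[OF assms]) (simp add: card_triangle_arcs_HX[OF assms])
  finally show ?thesis by (simp add: power2_eq_square algebra_simps)
qed

lemma card_verts_HDN3:
  assumes "n \<ge> 2"
  shows "real (card (verts (HDN3 n))) = 21 * (real n)\<^sup>2 - 39 * real n + 19"
  using assms real_card_HX_verts[of n] card_flags_HX[OF assms]
  unfolding HDN3_def octahedra_card_verts[OF HX_simple_graph]
  by (simp add: power2_eq_square algebra_simps)

lemma card_edges_HDN3:
  assumes "n \<ge> 2"
  shows "real (card (edges (HDN3 n))) = 3 * (21 * (real n)\<^sup>2 - 41 * real n + 20)"
proof -
  have "2 * real (card (edges (HX n))) = real (\<Sum>v\<in>HX_verts n. card (neighbours (HX n) v))"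
    using handshake[OF HX_simple_graph, of n]
    unfolding degree_eq_card_neighbours[OF HX_simple_graph] verts_HX
    by (metis of_nat_mult of_nat_numeral)
  then have "2 * real (card (edges (HX n))) = 18 * (real n)\<^sup>2 - 30 * real n + 12"
    using sum_neighbours_HX[OF assms] by simp
  then show ?thesis
    using card_flags_HX[OF assms]
    unfolding HDN3_def octahedra_card_edges[OF HX_simple_graph]
    by (simp add: power2_eq_square algebra_simps)
qed

text \<open>On old vertices the weight depends on the position only, so it is a combination of 1 and of the
  indicators of the interior and of the corners. The factor 210 clears the denominators of the weights
  and of their products.\<close>

lemma edge_sum_HDN3:
  assumes n: "n \<ge> 3"
  shows "210 * (\<Sum>e\<in>edges (HDN3 n). 1 / sqrt (\<Prod>p\<in>e. real (degree (HDN3 n) p))) =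
    917 + 1470 * sqrt 2 - 756 * sqrt 10 + 360 * sqrt 7 + 36 * sqrt 70 + 30 * sqrt 14 - 168 * sqrt 5
    + 7 * (- 307 - 270 * sqrt 2 + 12 * sqrt 5 + 54 * sqrt 10) * real n
    + 210 * (5 + 3 * sqrt 2) * (real n)\<^sup>2"
proof -
  have n2: "n \<ge> 2" using n by simp
  define w where "w v = 1 / sqrt (real (degree (HDN3 n) (Old v)))" for v
  define \<alpha> \<beta> \<gamma> where "\<alpha> = 1 / sqrt (18::real)" and "\<beta> = 1 / sqrt (10::real)" and "\<gamma> = 1 / sqrt (7::real)"
  have w: "w v = (if v \<in> HX_verts (n - 1) then \<alpha> else if v \<in> HX_corners n then \<gamma> else \<beta>)"
    if "v \<in> HX_verts n" for v
    by (simp add: w_def degree_HDN3_Old[OF n2 that] \<alpha>_def \<beta>_def \<gamma>_def)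
  have sub: "HX_verts (n - 1) \<subseteq> HX_verts n" "HX_corners n \<subseteq> HX_verts n - HX_verts (n - 1)"
    using HX_inner_subset HX_corners_subset[OF n2] by auto
  have old_old: "(\<Sum>v\<in>HX_verts n. w v * (\<Sum>q\<in>neighbours (HX n) v. w q)) =
      \<beta>\<^sup>2 * (18 * (real n)\<^sup>2 - 30 * real n + 12) + (\<alpha> - \<beta>)\<^sup>2 * (18 * (real n)\<^sup>2 - 66 * real n + 60)
      + 2 * \<beta> * (\<alpha> - \<beta>) * (18 * (real n)\<^sup>2 - 54 * real n + 42) + 36 * \<beta> * (\<gamma> - \<beta>)
      + 12 * (\<alpha> - \<beta>) * (\<gamma> - \<beta>)"
  proof -
    have "w v = \<beta> + (\<alpha> - \<beta>) * of_bool (v \<in> HX_verts (n - 1))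
        + (\<gamma> - \<beta>) * of_bool (v \<in> HX_corners n)" if "v \<in> verts (HX n)" for v
      using that sub by (auto simp: w)
    from arc_sum_two_indicators[OF HX_simple_graph _ _ this, unfolded verts_HX] sub
    show ?thesis by (simp add: subset_iff arcs_between_HX[OF n, simplified])
  qed
  have old_new: "(\<Sum>v\<in>HX_verts n. real (card (triangle_arcs (HX n) v)) * w v) =
      12 * \<alpha> * (3 * (real n)\<^sup>2 - 9 * real n + 7) + 4 * \<gamma> * 6 + 6 * \<beta> * (6 * real n - 12)"
    by (rule sum_HX_by_position[OF n2]) (simp add: card_triangle_arcs_HX[OF n2] w)
  have total: "(\<Sum>e\<in>edges (HDN3 n). 1 / sqrt (\<Prod>p\<in>e. real (degree (HDN3 n) p))) =
      (\<Sum>v\<in>HX_verts n. w v * (\<Sum>q\<in>neighbours (HX n) v. w q)) / 2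
      + (\<Sum>v\<in>HX_verts n. real (card (triangle_arcs (HX n) v)) * w v) / 2
      + real (card (flags (HX n))) / 4"
    using octahedra_edge_sum[OF HX_simple_graph, of w n] by (simp add: w_def HDN3_def)
  have "sqrt 18 = 3 * sqrt (2::real)" using real_sqrt_mult[of 9 2] by simp
  then have \<alpha>: "\<alpha> = sqrt 2 / 6" by (simp add: \<alpha>_def field_simps)
  have \<beta>: "\<beta> = sqrt 10 / 10" by (simp add: \<beta>_def field_simps)
  have \<gamma>: "\<gamma> = sqrt 7 / 7" by (simp add: \<gamma>_def field_simps)
  have "sqrt 2 * sqrt 10 = 2 * sqrt (5::real)"
    using real_sqrt_mult[of 4 5] by (simp flip: real_sqrt_mult)
  then have products: "\<alpha> * \<alpha> = 1 / 18" "\<beta> * \<beta> = 1 / 10" "\<alpha> * \<beta> = sqrt 5 / 30"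
    "\<beta> * \<gamma> = sqrt 70 / 70" "\<alpha> * \<gamma> = sqrt 14 / 42"
    by (simp_all add: \<alpha> \<beta> \<gamma> flip: real_sqrt_mult)
  \<comment> \<open>Collecting by products of weights recovers the numbers of edges by type (doubled).\<close>
  have old_old': "(\<Sum>v\<in>HX_verts n. w v * (\<Sum>q\<in>neighbours (HX n) v. w q)) =
      \<beta> * \<beta> * (12 * real n - 36) + \<alpha> * \<alpha> * (18 * (real n)\<^sup>2 - 66 * real n + 60)
      + \<alpha> * \<beta> * (24 * real n - 48) + 24 * (\<beta> * \<gamma>) + 12 * (\<alpha> * \<gamma>)"
    unfolding old_old by (simp add: power2_eq_square algebra_simps)
  show ?thesis
    unfolding total old_old' old_new card_flags_HX[OF n2] products
    unfolding \<alpha> \<beta> \<gamma> by (simp add: power2_eq_square field_simps)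
qed

theorem theorem2p1p2:
  "\<exists>c::real. \<bar>c - 1595.47\<bar> \<le> 0.005 \<and>
     (\<forall>n::nat. n \<ge> 4 \<longrightarrow>
        balaban_index (HDN3 n) =
          (20 - 41 * real n + 21 * (real n)^2) *
          (c + 7 * (- 307 - 270 * sqrt 2 + 12 * sqrt 5 + 54 * sqrt 10) * real n
             + 210 * (5 + 3 * sqrt 2) * (real n)^2)
          / (70 * (43 - 84 * real n + 42 * (real n)^2)))"
proof (intro exI conjI allI impI)
  show "\<bar>917 + 1470 * sqrt 2 - 756 * sqrt 10 + 360 * sqrt 7 + 36 * sqrt 70 + 30 * sqrt 14
     - 168 * sqrt 5 - 1595.47\<bar> \<le> (0.005 :: real)" by (rule balaban_constant_bounds)
next
  fix n :: nat assume "n \<ge> 4"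
  then have n: "n \<ge> 3" "n \<ge> 2" by auto
  define S where "S = (\<Sum>e\<in>edges (HDN3 n). 1 / sqrt (\<Prod>p\<in>e. real (degree (HDN3 n) p)))"
  have cyclomatic: "real (card (edges (HDN3 n))) - real (card (verts (HDN3 n))) + 2
      = 43 - 84 * real n + 42 * (real n)\<^sup>2"
    unfolding card_edges_HDN3[OF n(2)] card_verts_HDN3[OF n(2)] by simp
  have "balaban_index (HDN3 n)
      = 3 * (20 - 41 * real n + 21 * (real n)\<^sup>2) / (43 - 84 * real n + 42 * (real n)\<^sup>2) * S"
    unfolding balaban_index_def S_def[symmetric] cyclomatic
    unfolding card_edges_HDN3[OF n(2)] by (simp add: algebra_simps)
  also have "\<dots> = (20 - 41 * real n + 21 * (real n)\<^sup>2) * (210 * S)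
      / (70 * (43 - 84 * real n + 42 * (real n)\<^sup>2))"
  proof -
    have "3 * P / Q * S = P * (210 * S) / (70 * Q)" for P Q :: real by simp
    then show ?thesis .
  qed
  finally show "balaban_index (HDN3 n) = (20 - 41 * real n + 21 * (real n)\<^sup>2) *
      (917 + 1470 * sqrt 2 - 756 * sqrt 10 + 360 * sqrt 7 + 36 * sqrt 70 + 30 * sqrt 14 - 168 * sqrt 5
       + 7 * (- 307 - 270 * sqrt 2 + 12 * sqrt 5 + 54 * sqrt 10) * real n
       + 210 * (5 + 3 * sqrt 2) * (real n)\<^sup>2)
      / (70 * (43 - 84 * real n + 42 * (real n)\<^sup>2))"
    unfolding S_def edge_sum_HDN3[OF n(1)] .
qed

end
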